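(* Let $n\ge 1$, let $G_{2,n+1}$ be the Grassmannian of lines in $\mathbb{RP}^n$ (real polynomial pencils $L=\{\alpha P+\beta Q\}$ of degree $n$), and let $\mathcal{D}_{2,n+1}\subset G_{2,n+1}$ be the set of nongeneric pencils. There exist $\left[\frac{n+1}{2}\right]$ different connected components of $\widetilde{G}_{2,n+1}=G_{2,n+1}\setminus\mathcal{D}_{2,n+1}$ in which the Wronskian $W(P,Q)$ has no real zeros at all.
   Context: $\mathbb{RP}^n$ is identified with the space of nonzero homogeneous polynomials of degree $n$ in two variables with real coefficients, up to a constant factor; equivalently, nonzero real polynomials in one variable of degree at most $n$ up to a constant factor. A pencil of degree $n$ is a line $L=\{\alpha P+\beta Q\}\subset\mathbb{RP}^n$, $(\alpha:\beta)\in\mathbb{RP}^1$. The Wronskian $W(P,Q)=PQ'-QP'$ is determined by $L$ up to a nonzero constant and is regarded as a form of degree $2n-2$ on $\mathbb{P}^1$ (so if its degree as a polynomial is $2n-2-j$, it has a zero of multiplicity $j$ at $\infty$, and $\infty$ counts as a real point). A pencil is *generic* if $W(P,Q)$ has no multiple real zeros and *nongeneric* otherwise. $[x]$ denotes the integer part of $x$. *)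

theory Defs
  imports "HOL-Analysis.Analysis" "HOL-Computational_Algebra.Polynomial"
begin

section \<open>Quotient topology\<close>

definition quotient_topology :: "'a topology \<Rightarrow> ('a \<Rightarrow> 'b) \<Rightarrow> 'b topology" where
  "quotient_topology X f =
     topology (\<lambda>U. U \<subseteq> f ` topspace X \<and> openin X {x \<in> topspace X. f x \<in> U})"

lemma openin_quotient_topology:
  "openin (quotient_topology X f) U \<longleftrightarrow>
     U \<subseteq> f ` topspace X \<and> openin X {x \<in> topspace X. f x \<in> U}"
proof -
  let ?O = "\<lambda>U. U \<subseteq> f ` topspace X \<and> openin X {x \<in> topspace X. f x \<in> U}"
  have "istopology ?O"
    unfolding istopology_def
  proof (intro conjI allI impI)
    fix S T assume ST: "?O S" "?O T"
    have eq: "{x \<in> topspace X. f x \<in> S \<inter> T} =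
        {x \<in> topspace X. f x \<in> S} \<inter> {x \<in> topspace X. f x \<in> T}" by auto
    show "S \<inter> T \<subseteq> f ` topspace X" using ST by blast
    show "openin X {x \<in> topspace X. f x \<in> S \<inter> T}"
      unfolding eq using ST by (intro openin_Int) blast+
  next
    fix K assume K: "\<forall>S\<in>K. ?O S"
    show "\<Union>K \<subseteq> f ` topspace X" using K by blast
    have eq: "{x \<in> topspace X. f x \<in> \<Union>K} = (\<Union>S\<in>K. {x \<in> topspace X. f x \<in> S})" by auto
    show "openin X {x \<in> topspace X. f x \<in> \<Union>K}"
      unfolding eq using K by (intro openin_Union) blast
  qed
  then show ?thesis
    unfolding quotient_topology_def by (simp add: topology_inverse')
qed

lemma topspace_quotient_topology [simp]:
  "topspace (quotient_topology X f) = f ` topspace X"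
proof
  show "topspace (quotient_topology X f) \<subseteq> f ` topspace X"
    using openin_topspace[of "quotient_topology X f"] openin_quotient_topology[of X f] by metis
  have "{x \<in> topspace X. f x \<in> f ` topspace X} = topspace X" by auto
  then show "f ` topspace X \<subseteq> topspace (quotient_topology X f)"
    using openin_subset[of "quotient_topology X f" "f ` topspace X"]
    by (simp add: openin_quotient_topology)
qed

lemma quotient_map_quotient_topology: "quotient_map X (quotient_topology X f) f"
  by (auto simp: quotient_map_def openin_quotient_topology)

section \<open>Pencils of real polynomials\<close>

global_interpretation rpoly: vector_space "smult :: real \<Rightarrow> real poly \<Rightarrow> real poly"
  by unfold_locales (simp_all add: smult_add_right smult_add_left)

text \<open>The Grassmannian of lines in \<open>\<real>\<bbbP>\<^sup>n\<close>: a line is the projectivisation of a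
  two-dimensional subspace of the space of polynomials of degree at most \<open>n\<close>.\<close>

definition pencils :: "nat \<Rightarrow> real poly set set" where
  "pencils n = {L. rpoly.subspace L \<and> L \<subseteq> {P. degree P \<le> n} \<and> rpoly.dim L = 2}"

text \<open>On polynomials of degree at most \<open>n\<close> this is the Euclidean topology of the
  coefficient vectors.\<close>

definition poly_topology :: "nat \<Rightarrow> real poly topology" where
  "poly_topology n =
     pullback_topology {P. degree P \<le> n} coeff (euclidean :: (nat \<Rightarrow> real) topology)"

definition frame_topology :: "nat \<Rightarrow> (real poly \<times> real poly) topology" where
  "frame_topology n =
     subtopology (prod_topology (poly_topology n) (poly_topology n))
       {(P, Q). rpoly.span {P, Q} \<in> pencils n}"

definition grassmannian :: "nat \<Rightarrow> real poly set topology" where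
  "grassmannian n = quotient_topology (frame_topology n) (\<lambda>(P, Q). rpoly.span {P, Q})"

section \<open>The Wronskian\<close>

definition wronskian :: "real poly \<Rightarrow> real poly \<Rightarrow> real poly" where
  "wronskian P Q = P * pderiv Q - Q * pderiv P"

datatype real_proj_line = Affine real | Infinity

text \<open>Multiplicity of a zero of a nonzero polynomial \<open>W\<close> regarded as a form of degree \<open>d\<close>
  (where \<open>degree W \<le> d\<close>).\<close>

fun zero_mult :: "nat \<Rightarrow> real poly \<Rightarrow> real_proj_line \<Rightarrow> nat" where
  "zero_mult d W (Affine x) = order x W"
| "zero_mult d W Infinity = d - degree W"

text \<open>Every pencil is spanned by some pair, and the Wronskians of two such pairs differ by
  a nonzero constant, so the universal quantifiers over \<open>P\<close> and \<open>Q\<close> below only express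
  independence of the choice.\<close>

definition generic_pencil :: "nat \<Rightarrow> real poly set \<Rightarrow> bool" where
  "generic_pencil n L \<longleftrightarrow>
     (\<forall>P Q. rpoly.span {P, Q} = L \<longrightarrow> (\<forall>x. zero_mult (2 * n - 2) (wronskian P Q) x \<le> 1))"

definition wronskian_no_real_zeros :: "nat \<Rightarrow> real poly set \<Rightarrow> bool" where
  "wronskian_no_real_zeros n L \<longleftrightarrow>
     (\<forall>P Q. rpoly.span {P, Q} = L \<longrightarrow> (\<forall>x. zero_mult (2 * n - 2) (wronskian P Q) x = 0))"

definition nongeneric_pencils :: "nat \<Rightarrow> real poly set set" where
  "nongeneric_pencils n = {L \<in> pencils n. \<not> generic_pencil n L}"

definition generic_grassmannian :: "nat \<Rightarrow> real poly set topology" where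
  "generic_grassmannian n = subtopology (grassmannian n) (pencils n - nongeneric_pencils n)"

lemma wronskian_change_basis:
  "wronskian (smult a P + smult b Q) (smult c P + smult d Q) =
     smult (a * d - b * c) (wronskian P Q)"
  by (rule poly_ext) (simp add: wronskian_def pderiv_add pderiv_smult algebra_simps)

lemma pencil_spanned_by_pair:
  assumes "L \<in> pencils n"
  obtains P Q where "P \<noteq> Q" "\<not> rpoly.dependent {P, Q}" "rpoly.span {P, Q} = L"
proof -
  have L: "rpoly.subspace L" "rpoly.dim L = 2" using assms by (auto simp: pencils_def)
  obtain B where B: "B \<subseteq> L" "\<not> rpoly.dependent B" "L \<subseteq> rpoly.span B" "card B = rpoly.dim L"
    using rpoly.basis_exists by blast
  from B(4) L(2) obtain P Q where PQ: "B = {P, Q}" "P \<noteq> Q" by (auto simp: card_2_iff)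
  have "rpoly.span B = L" using B L by (simp add: rpoly.span_minimal subset_antisym)
  then show thesis using that PQ B by auto
qed

lemma topspace_grassmannian: "topspace (grassmannian n) = pencils n"
proof -
  have t: "topspace (frame_topology n) = {(P, Q). rpoly.span {P, Q} \<in> pencils n}"
  proof -
    have "degree P \<le> n \<and> degree Q \<le> n" if "rpoly.span {P, Q} \<in> pencils n" for P Q
      using that rpoly.span_base[of P "{P, Q}"] rpoly.span_base[of Q "{P, Q}"]
      by (auto simp: pencils_def)
    then show ?thesis
      by (auto simp: frame_topology_def poly_topology_def topspace_pullback_topology)
  qed
  show ?thesis
  proof
    show "topspace (grassmannian n) \<subseteq> pencils n"
      by (auto simp: grassmannian_def t)
    show "pencils n \<subseteq> topspace (grassmannian n)"
    proof
      fix L assume L: "L \<in> pencils n"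
      then obtain P Q where "rpoly.span {P, Q} = L" using pencil_spanned_by_pair by blast
      with L show "L \<in> topspace (grassmannian n)"
        by (auto simp: grassmannian_def t intro!: image_eqI[of _ _ "(P, Q)"])
    qed
  qed
qed

end

(* If the Wronskian of P and Q has no real zeros, then P and Q have no common real zero, so the
   loop t |-> (P, Q)(sin t, cos t), with P and Q read as binary forms of degree n, avoids the
   origin. Its winding number does not change under small perturbations of (P, Q), nor under base
   change of positive determinant, so, for frames oriented by W > 0, it is a locally constant
   function of the pencil. A generic pencil whose Wronskian does have a real zero has a simple one,
   so its Wronskian changes sign, which is an open condition; hence each set of pencils with
   zero-free Wronskian and given winding number is open and closed among the generic pencils. The
   real and imaginary parts of (1 + i x)^k (1 + x^2)^m, n = k + 2m, k >= 1, have winding number k. *)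

theory Submission
  imports Defs "HOL-Complex_Analysis.Winding_Numbers"
begin

section \<open>Binary forms\<close>

text \<open>The formal degree \<open>d\<close> is explicit because \<open>degree P\<close> may be
  smaller; for nonzero \<open>P\<close> the difference is the multiplicity of the zero at infinity,
  the point with \<open>y = 0\<close>. Coefficients above \<open>d\<close> are dropped, hence the
  degree bounds assumed below.\<close>

definition homog :: "nat \<Rightarrow> real poly \<Rightarrow> real \<Rightarrow> real \<Rightarrow> real" where
  "homog d P x y = (\<Sum>i\<le>d. coeff P i * x ^ i * y ^ (d - i))"

lemma homog_add: "homog d (P + Q) x y = homog d P x y + homog d Q x y"
  by (simp add: homog_def algebra_simps sum.distrib)

lemma homog_smult: "homog d (smult c P) x y = c * homog d P x y"
  by (simp add: homog_def algebra_simps sum_distrib_left)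

lemma homog_minus: "homog d (- P) x y = - homog d P x y"
  using homog_smult[of d "-1" P x y] by simp

lemma homog_diff: "homog d (P - Q) x y = homog d P x y - homog d Q x y"
  using homog_add[of d P "- Q" x y] homog_minus[of d Q x y] by simp

lemma homog_pCons_0: "homog (Suc d) (pCons 0 P) x y = x * homog d P x y"
proof -
  have "homog (Suc d) (pCons 0 P) x y
      = (\<Sum>i\<le>d. coeff (pCons 0 P) (Suc i) * x ^ Suc i * y ^ (Suc d - Suc i))"
    unfolding homog_def by (subst sum.atMost_Suc_shift) simp
  then show ?thesis
    by (simp add: homog_def sum_distrib_left algebra_simps)
qed

text \<open>Raising the formal degree by one adds a zero at infinity, which is the factor
  \<open>y\<close>.\<close>

lemma homog_Suc:
  assumes "degree P \<le> d"
  shows "homog (Suc d) P x y = y * homog d P x y"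
proof -
  have "coeff P (Suc d) = 0" using assms by (simp add: coeff_eq_0)
  then have "homog (Suc d) P x y = (\<Sum>i\<le>d. coeff P i * x ^ i * y ^ (Suc d - i))"
    by (simp add: homog_def)
  also have "\<dots> = (\<Sum>i\<le>d. y * (coeff P i * x ^ i * y ^ (d - i)))"
    by (rule sum.cong) (auto simp: Suc_diff_le)
  finally show ?thesis by (simp add: homog_def sum_distrib_left)
qed

text \<open>The factor \<open>x\<^sup>2 + y\<^sup>2\<close> equals 1 on the unit circle, so
  multiplying a pair by \<open>[:1, 0, 1:]\<close> raises the formal degree by two without changing
  its loop.\<close>

lemma homog_one_plus_square_mult:
  assumes "degree P \<le> d"
  shows "homog (d + 2) ([:1, 0, 1:] * P) x y = (x\<^sup>2 + y\<^sup>2) * homog d P x y"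
proof -
  have "[:1, 0, 1:] * P = P + pCons 0 (pCons 0 P)" by simp
  moreover have "degree P \<le> Suc d" using assms by simp
  ultimately show ?thesis
    using assms by (simp add: homog_add homog_pCons_0 homog_Suc power2_eq_square algebra_simps)
qed

lemma degree_one_plus_square_power_mult:
  assumes "degree P \<le> d"
  shows "degree ([:1, 0, 1:] ^ m * P :: real poly) \<le> d + 2 * m"
proof -
  have "degree ([:1, 0, 1:] ^ m * P :: real poly) \<le> degree ([:1, 0, 1:] ^ m :: real poly) + degree P"
    by (rule degree_mult_le)
  moreover have "degree ([:1, 0, 1:] ^ m :: real poly) \<le> 2 * m"
    using degree_power_le[of "[:1, 0, 1:] :: real poly" m] by simp
  ultimately show ?thesis using assms by simp
qed

lemma homog_one_plus_square_power_mult: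
  assumes "degree P \<le> d"
  shows "homog (d + 2 * m) ([:1, 0, 1:] ^ m * P) x y = (x\<^sup>2 + y\<^sup>2) ^ m * homog d P x y"
proof (induction m)
  case (Suc m)
  have "homog (d + 2 * Suc m) ([:1, 0, 1:] ^ Suc m * P) x y
      = homog (d + 2 * m + 2) ([:1, 0, 1:] * ([:1, 0, 1:] ^ m * P)) x y"
    by (simp only: power_Suc mult.assoc) (simp add: algebra_simps)
  then show ?case
    unfolding homog_one_plus_square_mult[OF degree_one_plus_square_power_mult[OF assms]]
    by (simp add: Suc)
qed simp

lemma poly_eq_sum_upto:
  fixes P :: "'a::comm_semiring_1 poly"
  assumes "degree P \<le> d"
  shows "poly P x = (\<Sum>i\<le>d. coeff P i * x ^ i)"
  unfolding poly_altdef using assms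
  by (intro sum.mono_neutral_left) (auto simp: coeff_eq_0)

lemma homog_affine:
  assumes "degree P \<le> d" "y \<noteq> 0"
  shows "homog d P x y = y ^ d * poly P (x / y)"
proof -
  have "homog d P x y = (\<Sum>i\<le>d. y ^ d * (coeff P i * (x / y) ^ i))"
    unfolding homog_def
  proof (rule sum.cong)
    fix i assume "i \<in> {..d}"
    then have "y ^ d = y ^ i * y ^ (d - i)" by (simp flip: power_add)
    then show "coeff P i * x ^ i * y ^ (d - i) = y ^ d * (coeff P i * (x / y) ^ i)"
      using assms by (simp add: power_divide)
  qed simp
  then show ?thesis
    using assms(1) by (simp add: poly_eq_sum_upto sum_distrib_left)
qed

lemma homog_infinity: "homog d P x 0 = coeff P d * x ^ d"
proof -
  have "homog d P x 0 = (\<Sum>i\<in>{d}. coeff P i * x ^ i * 0 ^ (d - i))"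
    unfolding homog_def by (rule sum.mono_neutral_right) auto
  then show ?thesis by simp
qed

text \<open>Every monomial is at most 1 in absolute value here. The bound is uniform in the point,
  so closeness of coefficients controls a form along the whole circle.\<close>

lemma homog_diff_bound:
  assumes "\<bar>x\<bar> \<le> 1" "\<bar>y\<bar> \<le> 1"
  shows "\<bar>homog d P x y - homog d Q x y\<bar> \<le> (\<Sum>i\<le>d. \<bar>coeff P i - coeff Q i\<bar>)"
proof -
  have "\<bar>homog d P x y - homog d Q x y\<bar> = \<bar>\<Sum>i\<le>d. (coeff P i - coeff Q i) * (x ^ i * y ^ (d - i))\<bar>"
    by (simp add: homog_def algebra_simps sum_subtractf)
  also have "\<dots> \<le> (\<Sum>i\<le>d. \<bar>coeff P i - coeff Q i\<bar> * (\<bar>x\<bar> ^ i * \<bar>y\<bar> ^ (d - i)))"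
    by (rule order_trans[OF sum_abs]) (simp add: abs_mult power_abs)
  also have "\<dots> \<le> (\<Sum>i\<le>d. \<bar>coeff P i - coeff Q i\<bar> * (1 * 1))"
    using assms by (intro sum_mono mult_left_mono mult_mono power_le_one) auto
  finally show ?thesis by simp
qed

lemma continuous_on_homog [continuous_intros]:
  assumes "continuous_on S f" "continuous_on S g"
  shows "continuous_on S (\<lambda>t. homog d P (f t) (g t))"
  unfolding homog_def by (intro continuous_intros assms)

section \<open>Wronskians and frames\<close>

text \<open>In degree \<open>2 * n - 1\<close> only the coefficients of index \<open>n\<close> meet,
  and beyond it nothing does. The value is symmetric in \<open>P\<close> and \<open>Q\<close>, so it
  cancels in the Wronskian, whose degree is therefore at most \<open>2 * n - 2\<close>.\<close>

lemma coeff_mult_pderiv_top: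
  fixes P Q :: "real poly"
  assumes "degree P \<le> n" "degree Q \<le> n" "2 * n \<le> m + 1"
  shows "coeff (P * pderiv Q) m = (if m + 1 = 2 * n then real n * coeff P n * coeff Q n else 0)"
proof -
  have zero: "coeff P j * coeff (pderiv Q) (m - j) = 0"
    if "j \<le> m" "\<not> (m + 1 = 2 * n \<and> j = n)" for j
  proof (cases "j \<le> n")
    case True
    then have "Suc (m - j) > n" using that assms by linarith
    then show ?thesis using assms by (simp add: coeff_pderiv coeff_eq_0)
  qed (use assms in \<open>simp add: coeff_eq_0\<close>)
  show ?thesis
  proof (cases "m + 1 = 2 * n")
    case True
    then have "n \<le> m" by linarith
    then have "(\<Sum>j\<le>m. coeff P j * coeff (pderiv Q) (m - j))
        = (\<Sum>j\<in>{n}. coeff P j * coeff (pderiv Q) (m - j))"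
      using zero by (intro sum.mono_neutral_right) auto
    moreover have "Suc (m - n) = n" using True by linarith
    ultimately show ?thesis using True by (simp add: coeff_mult coeff_pderiv)
  next
    case False
    then have "(\<Sum>j\<le>m. coeff P j * coeff (pderiv Q) (m - j)) = 0"
      using zero by (intro sum.neutral) blast
    then show ?thesis using False by (simp add: coeff_mult)
  qed
qed

lemma coeff_wronskian_top:
  assumes "degree P \<le> n" "degree Q \<le> n" "2 * n \<le> m + 1"
  shows "coeff (wronskian P Q) m = 0"
  using coeff_mult_pderiv_top[OF assms] coeff_mult_pderiv_top[OF assms(2,1,3)]
  by (simp add: wronskian_def)

lemma degree_wronskian:
  assumes "degree P \<le> n" "degree Q \<le> n"
  shows "degree (wronskian P Q) \<le> 2 * n - 2"
  by (intro degree_le allI impI coeff_wronskian_top[OF assms]) linarith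

lemma wronskian_swap: "wronskian Q P = - wronskian P Q"
  by (simp add: wronskian_def)

lemma wronskian_mult:
  "wronskian (R * P) (R * Q) = R\<^sup>2 * wronskian P Q"
  by (simp add: wronskian_def pderiv_mult power2_eq_square algebra_simps)

text \<open>Subtracting a multiple of \<open>P\<close> from \<open>Q\<close> gives an
  \<open>R\<close> that vanishes at a point \<open>x\<close> where \<open>P\<close> does not. If
  \<open>R\<close> is nonzero, the two sides of \<open>P * pderiv R = R * pderiv P\<close> have
  different orders at \<open>x\<close>, since differentiation lowers the order of \<open>R\<close>
  by one.\<close>

lemma wronskian_eq_0_imp_proportional:
  assumes "wronskian P Q = 0" "P \<noteq> 0"
  obtains c where "Q = smult c P"
proof -
  obtain x where x: "poly P x \<noteq> 0" using assms poly_all_0_iff_0 by blast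
  define R where "R = Q - smult (poly Q x / poly P x) P"
  have Rx: "poly R x = 0" using x by (simp add: R_def)
  have eq: "P * pderiv R = R * pderiv P"
    using assms(1) by (simp add: R_def wronskian_def pderiv_diff pderiv_smult algebra_simps)
  have "R = 0"
  proof (rule ccontr)
    assume "R \<noteq> 0"
    have R': "pderiv R \<noteq> 0"
    proof
      assume "pderiv R = 0"
      then obtain h where "R = [:h:]" using pderiv_iszero by blast
      then show False using \<open>R \<noteq> 0\<close> Rx by simp
    qed
    then have ne: "P * pderiv R \<noteq> 0" using assms by simp
    then have "order x P + order x (pderiv R) = order x R + order x (pderiv P)"
      using eq by (metis order_mult)
    moreover have "order x P = 0" using x order_root by blast
    moreover have "order x R = Suc (order x (pderiv R))"
      by (rule order_pderiv) fact+
    ultimately show False by simp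
  qed
  then show thesis using that R_def by simp
qed

section \<open>Pencils and their frames in terms of the Wronskian\<close>

text \<open>Vanishing of the Wronskian means linear dependence, so the dimension condition becomes a
  condition on the coefficients of \<open>P\<close> and \<open>Q\<close>.\<close>

lemma pencil_iff_wronskian_nonzero:
  "rpoly.span {P, Q} \<in> pencils n \<longleftrightarrow> degree P \<le> n \<and> degree Q \<le> n \<and> wronskian P Q \<noteq> 0"
proof
  assume L: "rpoly.span {P, Q} \<in> pencils n"
  have "P \<in> rpoly.span {P, Q}" "Q \<in> rpoly.span {P, Q}" by (simp_all add: rpoly.span_base)
  with L have "degree P \<le> n" "degree Q \<le> n" by (auto simp: pencils_def)
  moreover have "wronskian P Q \<noteq> 0"
  proof
    assume W: "wronskian P Q = 0"
    have "\<exists>R. {P, Q} \<subseteq> rpoly.span {R}"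
    proof (cases "P = 0")
      case True
      then show ?thesis by (metis empty_subsetI insert_subset rpoly.span_base rpoly.span_zero singletonI)
    next
      case False
      then obtain c where "Q = smult c P" using wronskian_eq_0_imp_proportional W by blast
      then show ?thesis
        by (intro exI[of _ P]) (auto intro: rpoly.span_base rpoly.span_scale)
    qed
    then obtain R where "{P, Q} \<subseteq> rpoly.span {R}" by blast
    then have "rpoly.dim {P, Q} \<le> card {R}" by (intro rpoly.dim_le_card) auto
    then show False using L by (simp add: pencils_def)
  qed
  ultimately show "degree P \<le> n \<and> degree Q \<le> n \<and> wronskian P Q \<noteq> 0" by simp
next
  assume A: "degree P \<le> n \<and> degree Q \<le> n \<and> wronskian P Q \<noteq> 0"
  have "P \<noteq> Q" "Q \<noteq> 0" using A by (auto simp: wronskian_def)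
  have "P \<notin> rpoly.span {Q}"
  proof
    assume "P \<in> rpoly.span {Q}"
    then obtain c where "P = smult c Q" by (auto simp: rpoly.span_singleton)
    then show False using A by (simp add: wronskian_def pderiv_smult)
  qed
  then have "rpoly.independent {P, Q}"
    using \<open>P \<noteq> Q\<close> \<open>Q \<noteq> 0\<close> by (simp add: rpoly.independent_insert)
  then have "rpoly.dim (rpoly.span {P, Q}) = 2"
    using \<open>P \<noteq> Q\<close> by (simp add: rpoly.dim_eq_card_independent)
  moreover have "rpoly.subspace {P. degree P \<le> n}"
    by (auto simp: rpoly.subspace_def degree_add_le intro: order_trans[OF degree_smult_le])
  then have "rpoly.span {P, Q} \<subseteq> {P. degree P \<le> n}"
    using A by (intro rpoly.span_minimal) auto
  ultimately show "rpoly.span {P, Q} \<in> pencils n"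
    by (simp add: pencils_def)
qed

text \<open>The determinant \<open>a * d - b * c\<close> is exposed because its sign decides whether
  two frames have the same orientation.\<close>

lemma change_of_frame:
  assumes "rpoly.span {P, Q} \<in> pencils n" "rpoly.span {P', Q'} = rpoly.span {P, Q}"
  obtains a b c d where
    "P' = smult a P + smult b Q" "Q' = smult c P + smult d Q" "a * d - b * c \<noteq> 0"
    "wronskian P' Q' = smult (a * d - b * c) (wronskian P Q)"
proof -
  have comb: "\<exists>a b. R = smult a P + smult b Q" if R: "R \<in> rpoly.span {P, Q}" for R
  proof -
    obtain a where "R - smult a P \<in> rpoly.span {Q}" using R by (auto simp: rpoly.span_breakdown_eq[of R])
    then obtain b where "R - smult a P = smult b Q" by (auto simp: rpoly.span_singleton)
    then show ?thesis by (metis add.commute diff_add_cancel)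
  qed
  have "P' \<in> rpoly.span {P, Q}" "Q' \<in> rpoly.span {P, Q}"
    unfolding assms(2)[symmetric] by (simp_all add: rpoly.span_base)
  then obtain a b c d where e: "P' = smult a P + smult b Q" "Q' = smult c P + smult d Q"
    using comb by meson
  then have W: "wronskian P' Q' = smult (a * d - b * c) (wronskian P Q)"
    by (simp only: wronskian_change_basis)
  moreover have "wronskian P' Q' \<noteq> 0"
    using assms pencil_iff_wronskian_nonzero[of P' Q' n] by simp
  ultimately have "a * d - b * c \<noteq> 0" by auto
  then show thesis using that e W by blast
qed

lemma wronskian_proportional:
  assumes "rpoly.span {P, Q} \<in> pencils n" "rpoly.span {P', Q'} = rpoly.span {P, Q}"
  shows "\<exists>c. c \<noteq> 0 \<and> wronskian P' Q' = smult c (wronskian P Q)"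
  by (rule change_of_frame[OF assms]) blast

section \<open>Positive frames and their winding number\<close>

text \<open>Every real linear map of the plane sends z to \<alpha> z + \<beta> \<open>cnj\<close> z
  and has determinant |\<alpha>|^2 - |\<beta>|^2; the norm hypothesis says that it preserves
  orientation. The conjugate term is removed first, then the factor \<alpha>.\<close>

lemma winding_number_real_linear_image:
  fixes \<alpha> \<beta> :: complex
  assumes g: "path g" "pathfinish g = pathstart g" "0 \<notin> path_image g" and ab: "norm \<beta> < norm \<alpha>"
  shows "winding_number (\<lambda>t. \<alpha> * g t + \<beta> * cnj (g t)) 0 = winding_number g 0"
proof -
  have nz: "g t \<noteq> 0" if "t \<in> {0..1}" for t
    using g(3) that by (auto simp: path_image_def)
  have pth: "path (\<lambda>t. a * g t + b * cnj (g t))"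
      "pathfinish (\<lambda>t. a * g t + b * cnj (g t)) = pathstart (\<lambda>t. a * g t + b * cnj (g t))" for a b
    using g(1,2) by (auto simp: path_def pathfinish_def pathstart_def intro!: continuous_intros)
  \<comment> \<open>The segment from \<open>h t\<close> to \<open>a * h t\<close> meets 0 only if
    \<open>a\<close> is real and nonpositive; otherwise the straight-line homotopy avoids 0.\<close>
  have scale_one: "winding_number (\<lambda>t. a * h t) 0 = winding_number h 0"
    if a: "a \<notin> \<real>\<^sub>\<le>\<^sub>0" and h: "path h" "pathfinish h = pathstart h" "\<And>t. t \<in> {0..1} \<Longrightarrow> h t \<noteq> 0"
    for a :: complex and h
  proof (rule winding_number_loops_linear_eq)
    show "path (\<lambda>t. a * h t)" "pathfinish (\<lambda>t. a * h t) = pathstart (\<lambda>t. a * h t)"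
      using h by (auto simp: path_def pathfinish_def pathstart_def intro!: continuous_intros)
    show "0 \<notin> closed_segment (h t) (a * h t)" if "t \<in> {0..1}" for t
    proof
      assume "0 \<in> closed_segment (h t) (a * h t)"
      then obtain u where u: "0 \<le> u" "u \<le> 1" "0 = (1 - u) *\<^sub>R h t + u *\<^sub>R (a * h t)"
        by (auto simp: closed_segment_def)
      then have "(of_real u * a - of_real (u - 1)) * h t = 0"
        by (simp add: scaleR_conv_of_real algebra_simps)
      then have e: "of_real u * a = of_real (u - 1)" using h(3)[OF that] by simp
      then have "u \<noteq> 0" by auto
      then have "a = of_real ((u - 1) / u)" using e by (simp add: field_simps)
      moreover have "(u - 1) / u \<le> 0" using u by (simp add: divide_nonpos_nonneg)
      ultimately show False using a nonpos_Reals_of_real_iff by blast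
    qed
  qed fact+
  \<comment> \<open>The conjugate term is shorter than \<open>\<alpha> * g t\<close> everywhere, so
    dropping it cannot move the loop across 0.\<close>
  have "winding_number (\<lambda>t. \<alpha> * g t + \<beta> * cnj (g t)) 0 = winding_number (\<lambda>t. \<alpha> * g t) 0"
  proof (rule winding_number_nearby_loops_eq)
    show "norm (\<alpha> * g t + \<beta> * cnj (g t) - \<alpha> * g t) < norm (\<alpha> * g t - 0)" if "t \<in> {0..1}" for t
      using nz[OF that] ab by (simp add: norm_mult)
  qed (use pth[of \<alpha> \<beta>] pth[of \<alpha> 0] in simp_all)
  also have "\<dots> = winding_number g 0"
  proof (cases "\<alpha> \<in> \<real>\<^sub>\<le>\<^sub>0")
    case True
    \<comment> \<open>A negative \<alpha> is the product of \<open>- \<i> * \<alpha>\<close> and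
      \<open>\<i>\<close>, both off the excluded ray, so \<open>scale_one\<close> is applied
      twice.\<close>
    have "\<alpha> \<noteq> 0" using ab by auto
    then have "Re \<alpha> < 0" "Im \<alpha> = 0" using True by (auto simp: complex_nonpos_Reals_iff complex_eq_iff)
    then have 1: "- \<i> * \<alpha> \<notin> \<real>\<^sub>\<le>\<^sub>0" "\<i> \<notin> \<real>\<^sub>\<le>\<^sub>0" by (auto simp: complex_nonpos_Reals_iff)
    have "winding_number (\<lambda>t. (- \<i> * \<alpha>) * (\<i> * g t)) 0 = winding_number (\<lambda>t. \<i> * g t) 0"
      using 1 nz pth[of \<i> 0] by (intro scale_one) simp_all
    also have "\<dots> = winding_number g 0"
      using 1 nz g by (intro scale_one) simp_all
    also have "(\<lambda>t. (- \<i> * \<alpha>) * (\<i> * g t)) = (\<lambda>t. \<alpha> * g t)"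
      by (simp add: complex_eq_iff fun_eq_iff)
    finally show ?thesis .
  next
    case False
    then show ?thesis using nz g by (intro scale_one) simp_all
  qed
  finally show ?thesis .
qed

text \<open>With x = sin and y = cos, \<open>Complex y x\<close> is \<open>cis\<close>, which makes
  the model pairs wind counterclockwise. The full circle is used because a half turn multiplies both
  forms by (-1)^n and closes the loop only for even \<open>n\<close>.\<close>

definition frame_loop :: "nat \<Rightarrow> real poly \<Rightarrow> real poly \<Rightarrow> real \<Rightarrow> complex" where
  "frame_loop n P Q t =
     Complex (homog n P (sin (2 * pi * t)) (cos (2 * pi * t)))
             (homog n Q (sin (2 * pi * t)) (cos (2 * pi * t)))"

lemma path_frame_loop: "path (frame_loop n P Q)"
  unfolding path_def frame_loop_def Complex_eq by (intro continuous_intros)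

lemma loop_frame_loop: "pathfinish (frame_loop n P Q) = pathstart (frame_loop n P Q)"
  by (simp add: frame_loop_def pathfinish_def pathstart_def)

text \<open>Positivity on the circle covers the point at infinity as well and fixes the order of
  \<open>P\<close> and \<open>Q\<close>. Since \<open>2 * n - 2\<close> is even, antipodal points
  give the same sign.\<close>

definition positive_frame :: "nat \<Rightarrow> real poly \<Rightarrow> real poly \<Rightarrow> bool" where
  "positive_frame n P Q \<longleftrightarrow> degree P \<le> n \<and> degree Q \<le> n \<and>
     (\<forall>t. homog (2 * n - 2) (wronskian P Q) (sin t) (cos t) > 0)"

lemma positive_frame_poly:
  assumes "positive_frame n P Q"
  shows "poly (wronskian P Q) x > 0"
proof -
  have "0 < homog (2 * n - 2) (wronskian P Q) (sin (arctan x)) (cos (arctan x))"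
    using assms by (simp add: positive_frame_def)
  also have "\<dots> = cos (arctan x) ^ (2 * n - 2) * poly (wronskian P Q) x"
    using assms degree_wronskian[of P n Q] tan_arctan[of x] 
    by (simp add: homog_affine positive_frame_def tan_def)
  finally show ?thesis
    by (simp add: zero_less_mult_iff cos_arctan)
qed

lemma positive_frame_coeff:
  assumes "positive_frame n P Q"
  shows "coeff (wronskian P Q) (2 * n - 2) > 0"
proof -
  have "0 < homog (2 * n - 2) (wronskian P Q) (sin (pi/2)) (cos (pi/2))"
    using assms unfolding positive_frame_def by blast
  then show ?thesis by (simp add: homog_infinity)
qed

text \<open>A common zero of the two forms would be a zero of the Wronskian form.\<close>

lemma frame_loop_nonzero:
  assumes "n \<ge> 1" "positive_frame n P Q"
  shows "frame_loop n P Q t \<noteq> 0"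
proof
  assume "frame_loop n P Q t = 0"
  then obtain s where s: "homog n P (sin s) (cos s) = 0" "homog n Q (sin s) (cos s) = 0"
    by (auto simp: frame_loop_def complex_eq_iff)
  have deg: "degree P \<le> n" "degree Q \<le> n" using assms by (auto simp: positive_frame_def)
  show False
  proof (cases "cos s = 0")
    case True
    then have "sin s \<noteq> 0" using sin_zero_abs_cos_one by fastforce
    then have "coeff P n = 0" "coeff Q n = 0" using s True by (auto simp: homog_infinity)
    then have "degree P \<le> n - 1" "degree Q \<le> n - 1"
      using deg by (metis One_nat_def degree_0 diff_is_0_eq' eq_zero_or_degree_less le_neq_implies_less less_Suc_eq_le Suc_pred zero_le not_less_zero leI le_0_eq nat_less_le)+
    \<comment> \<open>A common zero at infinity lowers both degrees, so the bound on the Wronskian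
      applies with \<open>n - 1\<close> in place of \<open>n\<close>.\<close>
    then have "coeff (wronskian P Q) (2 * n - 2) = 0"
      by (rule coeff_wronskian_top) auto
    then show False using positive_frame_coeff[OF assms(2)] by simp
  next
    case False
    then have "poly P (sin s / cos s) = 0" "poly Q (sin s / cos s) = 0"
      using s deg by (auto simp: homog_affine)
    then show False
      using positive_frame_poly[OF assms(2), of "sin s / cos s"] by (simp add: wronskian_def)
  qed
qed

lemma winding_number_frame_loop_change_of_frame:
  assumes "n \<ge> 1" "positive_frame n P Q" "a * d - b * c > 0"
  shows "winding_number (frame_loop n (smult a P + smult b Q) (smult c P + smult d Q)) 0
       = winding_number (frame_loop n P Q) 0"
proof -
  \<comment> \<open>These are the coefficients of z and \<open>cnj\<close> z for the real matrix
    with rows \<open>a\<close>, \<open>b\<close> and \<open>c\<close>, \<open>d\<close>.\<close>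
  define \<alpha> \<beta> where "\<alpha> = Complex ((a + d) / 2) ((c - b) / 2)" and "\<beta> = Complex ((a - d) / 2) ((b + c) / 2)"
  have "(norm \<alpha>)\<^sup>2 - (norm \<beta>)\<^sup>2 = a * d - b * c"
    by (simp add: \<alpha>_def \<beta>_def cmod_power2 field_simps) (simp add: power2_eq_square algebra_simps)
  then have "(norm \<beta>)\<^sup>2 < (norm \<alpha>)\<^sup>2" using assms by linarith
  then have "norm \<beta> < norm \<alpha>" by (rule power2_less_imp_less) simp
  moreover have "frame_loop n (smult a P + smult b Q) (smult c P + smult d Q)
      = (\<lambda>t. \<alpha> * frame_loop n P Q t + \<beta> * cnj (frame_loop n P Q t))"
    by (rule ext) (simp add: frame_loop_def \<alpha>_def \<beta>_def homog_add homog_smult complex_eq_iff field_simps)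
  moreover have "0 \<notin> path_image (frame_loop n P Q)"
    using frame_loop_nonzero[OF assms(1,2)] by (auto simp: path_image_def)
  ultimately show ?thesis
    using winding_number_real_linear_image[OF path_frame_loop loop_frame_loop] by simp
qed


text \<open>The Wronskian form has no zero on the circle, hence constant sign by connectedness;
  exchanging \<open>P\<close> and \<open>Q\<close> reverses that sign.\<close>

lemma positive_or_negative_frame:
  assumes "degree P \<le> n" "degree Q \<le> n"
    and "\<And>x. poly (wronskian P Q) x \<noteq> 0" "coeff (wronskian P Q) (2 * n - 2) \<noteq> 0"
  shows "positive_frame n P Q \<or> positive_frame n Q P"
proof -
  define f where "f t = homog (2 * n - 2) (wronskian P Q) (sin t) (cos t)" for t
  have nz: "f t \<noteq> 0" for t
  proof (cases "cos t = 0")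
    case True
    then have "sin t \<noteq> 0" using sin_zero_abs_cos_one by fastforce
    then show ?thesis using True assms by (simp add: f_def homog_infinity)
  next
    case False
    then show ?thesis using assms degree_wronskian[of P n Q] by (simp add: f_def homog_affine)
  qed
  have "connected (range f)"
    unfolding f_def by (intro connected_continuous_image continuous_intros) auto
  then have "(\<forall>t. f t > 0) \<or> (\<forall>t. f t < 0)"
    using nz connectedD_interval[of "range f" _ _ 0] by (metis linorder_neqE_linordered_idom less_imp_le rangeE rangeI)
  then show ?thesis
    using assms by (auto simp: positive_frame_def f_def wronskian_swap[of Q P] homog_minus)
qed

section \<open>Sign changes of the Wronskian\<close>

text \<open>Strict inequalities at two fixed points survive small changes of the coefficients. A
  simple zero at infinity is also detected at affine points, because the degree is then odd.\<close>

definition sign_changing :: "real poly \<Rightarrow> bool" where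
  "sign_changing W \<longleftrightarrow> (\<exists>x y. poly W x < 0 \<and> 0 < poly W y)"

lemma sign_changing_smult: "sign_changing W \<Longrightarrow> c \<noteq> 0 \<Longrightarrow> sign_changing (smult c W)"
  unfolding sign_changing_def by (cases "c > 0") (auto simp: zero_less_mult_iff mult_less_0_iff)

text \<open>Near \<open>x\<close> the cofactor of \<open>[:- x, 1:]\<close> keeps its sign while the
  linear factor changes sign.\<close>

lemma sign_changing_simple_zero:
  assumes "order x W = 1" "W \<noteq> 0"
  shows "sign_changing W"
proof -
  obtain R where R: "W = [:- x, 1:] * R" "\<not> [:- x, 1:] dvd R"
    using order_decomp[of W x] assms by auto
  then have "poly R x \<noteq> 0" by (simp add: poly_eq_0_iff_dvd)
  moreover have "isCont (poly R) x" by simp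
  ultimately obtain e where e: "e > 0" "\<And>y. \<bar>y - x\<bar> < e \<Longrightarrow> poly R y * poly R x > 0"
  proof -
    define g where "g y = poly R y * poly R x" for y
    have "isCont g x" unfolding g_def by (intro continuous_intros)
    then have "(g \<longlongrightarrow> g x) (nhds x)"
      unfolding isCont_def tendsto_at_iff_tendsto_nhds .
    moreover have "g x > 0"
      using \<open>poly R x \<noteq> 0\<close> unfolding g_def by (metis not_real_square_gt_zero)
    ultimately have "\<forall>\<^sub>F y in nhds x. g y > 0" by (rule order_tendstoD)
    then show thesis using that by (auto simp: eventually_nhds_metric dist_real_def g_def)
  qed
  have "poly R (x - e / 2) * poly R x > 0" "poly R (x + e / 2) * poly R x > 0"
    using e by auto
  then have "poly W (x - e / 2) * poly W (x + e / 2) < 0"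
    using e(1) unfolding R(1) by (auto simp: zero_less_mult_iff mult_less_0_iff)
  then show ?thesis
    unfolding sign_changing_def by (auto simp: mult_less_0_iff)
qed

text \<open>This serves a simple zero at infinity, where the degree is one less than the even number
  \<open>2 * n - 2\<close>.\<close>

lemma sign_changing_odd_degree:
  assumes "odd (degree W)"
  shows "sign_changing W"
proof -
  have pos: "\<exists>x y. poly V x < 0 \<and> 0 < poly V y" if "odd (degree V)" "lead_coeff V > 0" for V :: "real poly"
  proof -
    have "\<exists>y. 0 < poly V y"
      using poly_pinfty_gt_lc[of V] that by (metis order_less_le_trans order_refl)
    \<comment> \<open>In odd degree -V(-x) has the leading coefficient of V(x), which reduces
      behaviour at minus infinity to that at plus infinity.\<close>
    moreover have "\<exists>x. 0 < poly (- pcompose V [:0, -1:]) x"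
    proof -
      let ?U = "- pcompose V [:0, -1:]"
      have "lead_coeff ?U = lead_coeff V"
        using that by (simp add: lead_coeff_comp)
      then show ?thesis using poly_pinfty_gt_lc[of ?U] that by (metis order_less_le_trans order_refl)
    qed
    ultimately show ?thesis by (auto simp: poly_pcompose)
  qed
  show ?thesis
  proof (cases "lead_coeff W > 0")
    case True
    then show ?thesis using pos assms by (simp add: sign_changing_def)
  next
    case False
    moreover have "lead_coeff W \<noteq> 0" using assms by auto
    ultimately have "lead_coeff (- W) > 0" unfolding lead_coeff_minus by linarith
    then show ?thesis using pos[of "- W"] assms by (auto simp: sign_changing_def)
  qed
qed

section \<open>Open sets of pencils\<close>

lemma topspace_frame_topology:
  "topspace (frame_topology n) = {(P, Q). rpoly.span {P, Q} \<in> pencils n}"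
  by (auto simp: frame_topology_def poly_topology_def topspace_pullback_topology
      pencil_iff_wronskian_nonzero)

lemma continuous_map_frame_coeff:
  "continuous_map (frame_topology n) euclideanreal (\<lambda>p. coeff (fst p) i)"
  "continuous_map (frame_topology n) euclideanreal (\<lambda>p. coeff (snd p) i)"
proof -
  have c: "continuous_map (poly_topology n) euclideanreal (\<lambda>P. coeff P i)"
    unfolding poly_topology_def
    using continuous_map_pullback[of euclidean euclideanreal "\<lambda>f. f i" "{P. degree P \<le> n}" coeff]
    by (simp add: o_def)
  show "continuous_map (frame_topology n) euclideanreal (\<lambda>p. coeff (fst p) i)"
    "continuous_map (frame_topology n) euclideanreal (\<lambda>p. coeff (snd p) i)"
    unfolding frame_topology_def
    using continuous_map_compose[OF continuous_map_fst c] continuous_map_compose[OF continuous_map_snd c]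
    by (auto simp: o_def intro!: continuous_map_from_subtopology)
qed

lemma continuous_map_frame_wronskian_coeff:
  "continuous_map (frame_topology n) euclideanreal (\<lambda>p. coeff (wronskian (fst p) (snd p)) i)"
  unfolding wronskian_def coeff_diff coeff_mult coeff_pderiv
  by (intro continuous_intros continuous_map_frame_coeff) auto

lemma openin_sum_abs_diff_less:
  assumes "\<And>i. continuous_map X euclideanreal (f i)"
  shows "openin X {p \<in> topspace X. (\<Sum>i\<le>d::nat. \<bar>f i p - a i\<bar>) < e}"
proof -
  have "continuous_map X euclideanreal (\<lambda>p. \<Sum>i\<le>d. \<bar>f i p - a i\<bar>)"
    using assms by (intro continuous_intros) auto
  from openin_continuous_map_preimage[OF this, of "{..<e}"] show ?thesis by simp
qed

lemma continuous_positive_lower_bound: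
  fixes f :: "real \<Rightarrow> real"
  assumes "continuous_on UNIV f" "\<And>t. f t > 0"
  shows "\<exists>e>0. \<forall>t\<in>{a..b}. e < f t"
proof (cases "{a..b} = {}")
  case False
  have "continuous_on {a..b} f" using assms continuous_on_subset by blast
  then obtain x where "x \<in> {a..b}" "\<And>t. t \<in> {a..b} \<Longrightarrow> f x \<le> f t"
    using continuous_attains_inf[of "{a..b}" f] False by auto
  then show ?thesis using assms(2)[of x] by (intro exI[of _ "f x / 2"]) force
qed (auto intro: exI[of _ 1])

text \<open>Compactness gives a positive lower bound \<open>e\<close> for the Wronskian form on the
  circle and another, \<open>\<epsilon>\<close>, for the distance of the loop from 0. Frames with
  nearby coefficients stay within both margins.\<close>

lemma openin_positive_frames_winding_number:
  assumes "n \<ge> 1"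
  shows "openin (frame_topology n)
    {p \<in> topspace (frame_topology n). positive_frame n (fst p) (snd p) \<and>
       winding_number (frame_loop n (fst p) (snd p)) 0 = k}" (is "openin ?F ?S")
proof (subst openin_subopen, intro ballI)
  fix p assume "p \<in> ?S"
  then obtain P Q where p: "p = (P, Q)" "positive_frame n P Q" "(P, Q) \<in> topspace ?F"
    and k: "winding_number (frame_loop n P Q) 0 = k" by (cases p) auto
  define d where "d = 2 * n - 2"
  let ?w = "\<lambda>t. homog d (wronskian P Q) (sin t) (cos t)"
  have "continuous_on UNIV ?w" by (intro continuous_intros)
  moreover have "?w t > 0" for t using p(2) by (simp add: positive_frame_def d_def)
  ultimately obtain e where e: "e > 0" "\<And>t. t \<in> {0..2 * pi} \<Longrightarrow> e < ?w t"
    using continuous_positive_lower_bound[of ?w 0 "2 * pi"] by blast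
  let ?v = "\<lambda>t. norm (frame_loop n P Q t)"
  have "continuous_on UNIV ?v"
    unfolding frame_loop_def Complex_eq by (intro continuous_intros)
  moreover have "?v t > 0" for t using frame_loop_nonzero[OF assms p(2)] by simp
  ultimately obtain \<epsilon> where \<epsilon>: "\<epsilon> > 0" "\<And>t. t \<in> {0..1} \<Longrightarrow> \<epsilon> < ?v t"
    using continuous_positive_lower_bound[of ?v 0 1] by blast
  \<comment> \<open>\<open>?N1\<close> keeps the Wronskian form positive. \<open>?N2\<close> and
    \<open>?N3\<close> bound the change of each coordinate by half of \<epsilon>, so the loop moves
    by less than its distance from 0.\<close>
  let ?N1 = "{p \<in> topspace ?F. (\<Sum>i\<le>d. \<bar>coeff (wronskian (fst p) (snd p)) i - coeff (wronskian P Q) i\<bar>) < e}"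
  let ?N2 = "{p \<in> topspace ?F. (\<Sum>i\<le>n. \<bar>coeff (fst p) i - coeff P i\<bar>) < \<epsilon> / 2}"
  let ?N3 = "{p \<in> topspace ?F. (\<Sum>i\<le>n. \<bar>coeff (snd p) i - coeff Q i\<bar>) < \<epsilon> / 2}"
  have "openin ?F (?N1 \<inter> ?N2 \<inter> ?N3)"
    by (intro openin_Int openin_sum_abs_diff_less continuous_map_frame_coeff continuous_map_frame_wronskian_coeff)
  moreover have "p \<in> ?N1 \<inter> ?N2 \<inter> ?N3"
    using p e \<epsilon> by simp
  moreover have "?N1 \<inter> ?N2 \<inter> ?N3 \<subseteq> ?S"
  proof
    fix q assume q: "q \<in> ?N1 \<inter> ?N2 \<inter> ?N3"
    obtain P' Q' where q': "q = (P', Q')" by (cases q)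
    have top: "(P', Q') \<in> topspace ?F" using q q' by simp
    have near: "(\<Sum>i\<le>d. \<bar>coeff (wronskian P' Q') i - coeff (wronskian P Q) i\<bar>) < e"
      "(\<Sum>i\<le>n. \<bar>coeff P' i - coeff P i\<bar>) < \<epsilon> / 2" "(\<Sum>i\<le>n. \<bar>coeff Q' i - coeff Q i\<bar>) < \<epsilon> / 2"
      using q q' by auto
    have "0 < homog d (wronskian P' Q') (sin t) (cos t)" for t
    proof -
      \<comment> \<open>Periodicity moves the parameter into the compact interval on which
        \<open>e\<close> is a lower bound.\<close>
      obtain s where s: "s \<in> {0..2 * pi}" "sin t = sin s" "cos t = cos s"
        using sincos_total_2pi[of "cos t" "sin t"] by (metis atLeastAtMost_iff less_imp_le sin_cos_squared_add2)
      have "\<bar>homog d (wronskian P' Q') (sin s) (cos s) - homog d (wronskian P Q) (sin s) (cos s)\<bar> < e"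
        using homog_diff_bound[of "sin s" "cos s" d "wronskian P' Q'" "wronskian P Q"] near(1) by simp
      then show ?thesis using e(2)[OF s(1)] s by simp
    qed
    then have "positive_frame n P' Q'"
      using top by (simp add: positive_frame_def d_def topspace_frame_topology pencil_iff_wronskian_nonzero)
    moreover have "winding_number (frame_loop n P' Q') 0 = winding_number (frame_loop n P Q) 0"
    proof (rule winding_number_nearby_loops_eq[OF path_frame_loop path_frame_loop loop_frame_loop loop_frame_loop])
      fix t :: real assume t: "t \<in> {0..1}"
      define x y where "x = sin (2 * pi * t)" and "y = cos (2 * pi * t)"
      have "norm (frame_loop n P' Q' t - frame_loop n P Q t)
          \<le> \<bar>homog n P' x y - homog n P x y\<bar> + \<bar>homog n Q' x y - homog n Q x y\<bar>"
        using cmod_le[of "frame_loop n P' Q' t - frame_loop n P Q t"] by (simp add: frame_loop_def x_def y_def)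
      also have "\<dots> < \<epsilon> / 2 + \<epsilon> / 2"
        using homog_diff_bound[of x y n P' P] homog_diff_bound[of x y n Q' Q] near(2,3)
        by (simp add: x_def y_def)
      finally show "norm (frame_loop n P' Q' t - frame_loop n P Q t) < norm (frame_loop n P Q t - 0)"
        using \<epsilon>(2)[OF t] by simp
    qed
    ultimately show "q \<in> ?S" using top k q' by simp
  qed
  ultimately show "\<exists>T. openin ?F T \<and> p \<in> T \<and> T \<subseteq> ?S" by blast
qed

lemma openin_grassmannian_iff:
  "openin (grassmannian n) U \<longleftrightarrow> U \<subseteq> pencils n \<and>
     openin (frame_topology n) {p \<in> topspace (frame_topology n). rpoly.span {fst p, snd p} \<in> U}"
proof -
  have "(\<lambda>(P, Q). rpoly.span {P, Q}) ` topspace (frame_topology n) = pencils n"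
    using topspace_grassmannian[of n] by (simp add: grassmannian_def)
  then show ?thesis
    by (simp add: grassmannian_def openin_quotient_topology case_prod_unfold)
qed

section \<open>Pencils sorted by winding number or by a sign change\<close>

text \<open>The index is complex because \<open>winding_number\<close> is. For
  \<open>n \<ge> 1\<close> all positive frames of one pencil share their winding number, so the
  choice of frame is immaterial.\<close>

definition winding_pencils :: "nat \<Rightarrow> complex \<Rightarrow> real poly set set" where
  "winding_pencils n k = {L. \<exists>P Q. L = rpoly.span {P, Q} \<and> positive_frame n P Q \<and>
     winding_number (frame_loop n P Q) 0 = k}"

definition sign_changing_pencils :: "nat \<Rightarrow> real poly set set" where
  "sign_changing_pencils n = {L \<in> pencils n. \<exists>P Q. L = rpoly.span {P, Q} \<and> sign_changing (wronskian P Q)}"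

lemma positive_frame_pencil:
  assumes "positive_frame n P Q"
  shows "rpoly.span {P, Q} \<in> pencils n"
  using assms positive_frame_poly[OF assms, of 0]
  by (auto simp: pencil_iff_wronskian_nonzero positive_frame_def)

text \<open>The determinant relating the frames multiplies the Wronskian, so it is positive when
  both Wronskians are.\<close>

lemma winding_number_positive_frames_eq:
  assumes "n \<ge> 1" "positive_frame n P Q" "positive_frame n P' Q'"
    and "rpoly.span {P', Q'} = rpoly.span {P, Q}"
  shows "winding_number (frame_loop n P' Q') 0 = winding_number (frame_loop n P Q) 0"
proof -
  obtain a b c d where e: "P' = smult a P + smult b Q" "Q' = smult c P + smult d Q"
    "wronskian P' Q' = smult (a * d - b * c) (wronskian P Q)"
    using change_of_frame[OF positive_frame_pencil[OF assms(2)] assms(4)] by metis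
  have "0 < (a * d - b * c) * poly (wronskian P Q) 0"
    using positive_frame_poly[OF assms(3), of 0] by (simp only: e(3) poly_smult)
  then have "a * d - b * c > 0"
    using positive_frame_poly[OF assms(2), of 0] by (simp add: zero_less_mult_iff)
  then show ?thesis
    unfolding e(1,2) by (rule winding_number_frame_loop_change_of_frame[OF assms(1,2)])
qed

text \<open>The Wronskian of every frame is a nonzero multiple of an everywhere positive one; the
  top coefficient deals with infinity.\<close>

lemma winding_pencil_no_real_zeros:
  assumes "L \<in> winding_pencils n k"
  shows "L \<in> pencils n" "wronskian_no_real_zeros n L" "L \<notin> sign_changing_pencils n"
proof -
  obtain P Q where L: "L = rpoly.span {P, Q}" and PQ: "positive_frame n P Q"
    using assms by (auto simp: winding_pencils_def)
  show pen: "L \<in> pencils n" using L PQ positive_frame_pencil by simp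
  have multiple: "\<exists>c. c \<noteq> 0 \<and> wronskian P' Q' = smult c (wronskian P Q)"
    if "rpoly.span {P', Q'} = L" for P' Q'
    using wronskian_proportional[of P Q n P' Q'] pen L that by simp
  show "wronskian_no_real_zeros n L"
    unfolding wronskian_no_real_zeros_def
  proof (intro allI impI)
    fix P' Q' x assume "rpoly.span {P', Q'} = L"
    then obtain c where c: "c \<noteq> 0" "wronskian P' Q' = smult c (wronskian P Q)"
      using multiple by blast
    show "zero_mult (2 * n - 2) (wronskian P' Q') x = 0"
    proof (cases x)
      case (Affine y)
      have "poly (wronskian P' Q') y \<noteq> 0"
        using c positive_frame_poly[OF PQ, of y] by simp
      then show ?thesis using Affine by (simp add: order_0I)
    next
      case Infinity
      have "coeff (wronskian P' Q') (2 * n - 2) \<noteq> 0"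
        using c positive_frame_coeff[OF PQ] by simp
      then have "2 * n - 2 \<le> degree (wronskian P' Q')" by (rule le_degree)
      then show ?thesis using Infinity by simp
    qed
  qed
  show "L \<notin> sign_changing_pencils n"
  proof
    assume "L \<in> sign_changing_pencils n"
    then obtain P' Q' where "rpoly.span {P', Q'} = L" "sign_changing (wronskian P' Q')"
      by (auto simp: sign_changing_pencils_def)
    moreover from this obtain c where c: "c \<noteq> 0" "wronskian P' Q' = smult c (wronskian P Q)"
      using multiple by blast
    ultimately have "sign_changing (smult (1 / c) (smult c (wronskian P Q)))"
      by (metis sign_changing_smult divide_eq_0_iff one_neq_zero)
    then have "sign_changing (wronskian P Q)" using c by simp
    then show False using positive_frame_poly[OF PQ] by (metis sign_changing_def less_asym)
  qed
qed

lemma winding_pencils_disjoint: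
  assumes "n \<ge> 1" "L \<in> winding_pencils n j" "L \<in> winding_pencils n k"
  shows "j = k"
proof -
  obtain P Q P' Q' where "L = rpoly.span {P, Q}" "positive_frame n P Q"
      "winding_number (frame_loop n P Q) 0 = j"
    and "L = rpoly.span {P', Q'}" "positive_frame n P' Q'"
      "winding_number (frame_loop n P' Q') 0 = k"
    using assms(2,3) unfolding winding_pencils_def by blast
  then show ?thesis using winding_number_positive_frames_eq[OF assms(1), of P Q P' Q'] by simp
qed

text \<open>All real zeros are simple. An affine one gives a sign change directly, one at infinity
  does so by parity of the degree, and without zeros the pair or its exchange is a positive
  frame.\<close>

lemma generic_pencil_cases:
  assumes "L \<in> pencils n" "generic_pencil n L"
  shows "L \<in> sign_changing_pencils n \<or> (\<exists>k. L \<in> winding_pencils n k)"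
proof -
  obtain P Q where L: "L = rpoly.span {P, Q}" using pencil_spanned_by_pair[OF assms(1)] by metis
  define W where "W = wronskian P Q"
  have PQ: "degree P \<le> n" "degree Q \<le> n" "W \<noteq> 0"
    using assms L pencil_iff_wronskian_nonzero by (auto simp: W_def)
  have simple: "zero_mult (2 * n - 2) W x \<le> 1" for x
    using assms(2) L by (simp add: generic_pencil_def W_def)
  have deg: "degree W \<le> 2 * n - 2" using degree_wronskian PQ by (simp add: W_def)
  consider x where "order x W = 1" | "2 * n - 2 - degree W = 1"
    | "\<And>x. order x W = 0" "degree W = 2 * n - 2"
    using simple[of "Affine _"] simple[of Infinity] deg by (force simp: le_Suc_eq)
  then show ?thesis
  proof cases
    case 1
    then show ?thesis
      using sign_changing_simple_zero PQ L assms by (auto simp: sign_changing_pencils_def W_def)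
  next
    case 2
    then have "2 * n - 2 = Suc (degree W)" by simp
    moreover have "even (2 * n - 2)" by simp
    ultimately have "odd (degree W)" by simp
    then show ?thesis
      using sign_changing_odd_degree L assms by (auto simp: sign_changing_pencils_def W_def)
  next
    case 3
    have "poly W x \<noteq> 0" for x using 3(1) PQ(3) order_root by blast
    moreover have "coeff W (2 * n - 2) \<noteq> 0" using 3(2) PQ(3) by (metis leading_coeff_0_iff)
    ultimately have "positive_frame n P Q \<or> positive_frame n Q P"
      using PQ by (intro positive_or_negative_frame) (auto simp: W_def)
    then show ?thesis
      using L by (auto simp: winding_pencils_def insert_commute)
  qed
qed

text \<open>Each frame of such a pencil is positive, possibly after exchanging its members. The
  preimage among frames is therefore the open set \<open>?S\<close> together with its preimage under
  the continuous exchange map.\<close>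

lemma openin_winding_pencils:
  assumes "n \<ge> 1"
  shows "openin (grassmannian n) (winding_pencils n k)"
  unfolding openin_grassmannian_iff
proof
  show "winding_pencils n k \<subseteq> pencils n" using winding_pencil_no_real_zeros(1) by blast
  let ?F = "frame_topology n"
  let ?S = "{p \<in> topspace ?F. positive_frame n (fst p) (snd p) \<and>
       winding_number (frame_loop n (fst p) (snd p)) 0 = k}"
  let ?sw = "\<lambda>p::real poly \<times> real poly. (snd p, fst p)"
  have swap: "continuous_map ?F ?F ?sw"
    unfolding frame_topology_def
    by (auto simp: continuous_map_in_subtopology insert_commute continuous_map_pairwise o_def
        intro!: continuous_map_from_subtopology continuous_map_fst continuous_map_snd)
  have "{p \<in> topspace ?F. rpoly.span {fst p, snd p} \<in> winding_pencils n k}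
      = ?S \<union> {p \<in> topspace ?F. ?sw p \<in> ?S}" (is "?A = ?B")
  proof
    have "rpoly.span {P, Q} \<in> winding_pencils n k \<and> rpoly.span {Q, P} \<in> winding_pencils n k"
      if "positive_frame n P Q" "winding_number (frame_loop n P Q) 0 = k" for P Q
      using that unfolding winding_pencils_def insert_commute[of Q P] by blast
    then show "?B \<subseteq> ?A" by auto
    show "?A \<subseteq> ?B"
    proof
      fix p assume p: "p \<in> ?A"
      obtain P Q where pq: "p = (P, Q)" by (cases p)
      obtain P' Q' where e: "rpoly.span {P, Q} = rpoly.span {P', Q'}" "positive_frame n P' Q'"
        "winding_number (frame_loop n P' Q') 0 = k"
        using p pq by (auto simp: winding_pencils_def)
      obtain a b c d where W: "a * d - b * c \<noteq> 0" "wronskian P Q = smult (a * d - b * c) (wronskian P' Q')"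
        using change_of_frame[OF positive_frame_pencil[OF e(2)] e(1)] by metis
      have "degree P \<le> n" "degree Q \<le> n" using p pq
        by (auto simp: topspace_frame_topology pencil_iff_wronskian_nonzero)
      then have "positive_frame n P Q \<or> positive_frame n Q P"
        using W positive_frame_poly[OF e(2)] positive_frame_coeff[OF e(2)]
        by (intro positive_or_negative_frame) (auto simp: less_imp_neq[symmetric])
      moreover have "winding_number (frame_loop n P Q) 0 = k" if "positive_frame n P Q"
        using winding_number_positive_frames_eq[OF assms e(2) that] e by simp
      moreover have "winding_number (frame_loop n Q P) 0 = k" if "positive_frame n Q P"
        using winding_number_positive_frames_eq[OF assms e(2) that] e by (simp add: insert_commute)
      ultimately show "p \<in> ?B"
        using p pq by (auto simp: topspace_frame_topology insert_commute)
    qed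
  qed
  moreover have "openin ?F ?S" using openin_positive_frames_winding_number assms by blast
  ultimately show "openin ?F {p \<in> topspace ?F. rpoly.span {fst p, snd p} \<in> winding_pencils n k}"
    using openin_Un[OF _ openin_continuous_map_preimage[OF swap, of ?S], of ?S] by (simp only:)
qed

text \<open>Evaluating the Wronskian at a fixed point is continuous in the frame; the preimage is a
  union over \<open>x\<close> and \<open>y\<close> of open sets.\<close>

lemma openin_sign_changing_pencils: "openin (grassmannian n) (sign_changing_pencils n)"
  unfolding openin_grassmannian_iff
proof
  show "sign_changing_pencils n \<subseteq> pencils n" by (auto simp: sign_changing_pencils_def)
  let ?F = "frame_topology n"
  let ?w = "\<lambda>x p. poly (wronskian (fst p) (snd p)) x"
  have "continuous_map ?F euclideanreal (\<lambda>p. \<Sum>i\<le>2 * n - 2. coeff (wronskian (fst p) (snd p)) i * x ^ i)" for x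
    by (intro continuous_intros continuous_map_frame_wronskian_coeff) auto
  then have cont: "continuous_map ?F euclideanreal (?w x)" for x
    by (rule continuous_map_eq)
      (auto simp: topspace_frame_topology pencil_iff_wronskian_nonzero degree_wronskian
        poly_eq_sum_upto[of _ "2 * n - 2"])
  have U: "openin ?F ({p \<in> topspace ?F. ?w x p \<in> {..<0}} \<inter> {p \<in> topspace ?F. ?w y p \<in> {0<..}})" for x y
    by (intro openin_Int openin_continuous_map_preimage[OF cont]) auto
  have "openin ?F (\<Union>x y. {p \<in> topspace ?F. ?w x p \<in> {..<0}} \<inter> {p \<in> topspace ?F. ?w y p \<in> {0<..}})"
    by (rule openin_Union, elim imageE, simp only:, rule openin_Union, elim imageE, simp only:, rule U)
  moreover have "{p \<in> topspace ?F. rpoly.span {fst p, snd p} \<in> sign_changing_pencils n}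
     = {p \<in> topspace ?F. sign_changing (wronskian (fst p) (snd p))}"
  proof -
    \<comment> \<open>Rescaling by a nonzero constant preserves sign changes, so the given frame can
      be tested in place of the one that exists by definition.\<close>
    have "rpoly.span {P, Q} \<in> sign_changing_pencils n \<longleftrightarrow> sign_changing (wronskian P Q)"
      if pen: "rpoly.span {P, Q} \<in> pencils n" for P Q
    proof
      assume "rpoly.span {P, Q} \<in> sign_changing_pencils n"
      then obtain P' Q' where e: "rpoly.span {P, Q} = rpoly.span {P', Q'}" "sign_changing (wronskian P' Q')"
        unfolding sign_changing_pencils_def by blast
      obtain c where "c \<noteq> 0" "wronskian P Q = smult c (wronskian P' Q')"
        using wronskian_proportional[of P' Q' n P Q] pen e(1) by metis
      then show "sign_changing (wronskian P Q)" using e(2) sign_changing_smult by simp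
    qed (use pen in \<open>unfold sign_changing_pencils_def, blast\<close>)
    then show ?thesis
      unfolding topspace_frame_topology by fastforce
  qed
  moreover have "\<dots> = (\<Union>x y. {p \<in> topspace ?F. ?w x p \<in> {..<0}} \<inter> {p \<in> topspace ?F. ?w y p \<in> {0<..}})"
    by (auto simp: sign_changing_def)
  ultimately show "openin ?F {p \<in> topspace ?F. rpoly.span {fst p, snd p} \<in> sign_changing_pencils n}"
    by simp
qed

section \<open>Pencils of prescribed degree\<close>

text \<open>Real and imaginary part of \<open>(1 + \<i> x) ^ k\<close>.\<close>

fun cpoly :: "nat \<Rightarrow> real poly" and spoly :: "nat \<Rightarrow> real poly" where
  "cpoly 0 = 1"
| "spoly 0 = 0"
| "cpoly (Suc k) = cpoly k - pCons 0 (spoly k)"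
| "spoly (Suc k) = spoly k + pCons 0 (cpoly k)"

lemma degree_cpoly_spoly: "degree (cpoly k) \<le> k \<and> degree (spoly k) \<le> k"
proof (induction k)
  case (Suc k)
  then have "degree (pCons 0 (cpoly k)) \<le> Suc k" "degree (pCons 0 (spoly k)) \<le> Suc k"
    using degree_pCons_le[of 0 "cpoly k"] degree_pCons_le[of 0 "spoly k"] by linarith+
  with Suc show ?case
    unfolding cpoly.simps spoly.simps by (intro conjI degree_diff_le degree_add_le) linarith+
qed simp

text \<open>Homogenising (1 + i x)^k gives (y + i x)^k.\<close>

lemma homog_cpoly_spoly:
  "Complex (homog k (cpoly k) x y) (homog k (spoly k) x y) = Complex y x ^ k"
proof (induction k)
  case 0
  then show ?case by (simp add: homog_def complex_eq_iff)
next
  case (Suc k)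
  have "Complex (homog (Suc k) (cpoly (Suc k)) x y) (homog (Suc k) (spoly (Suc k)) x y)
      = Complex y x * Complex (homog k (cpoly k) x y) (homog k (spoly k) x y)"
    using degree_cpoly_spoly[of k]
    by (simp add: homog_diff homog_add homog_pCons_0 homog_Suc complex_eq_iff)
  then show ?case by (simp add: Suc)
qed

text \<open>These are the real and imaginary parts of (k + 1) i (1 + i x)^k, the derivative of (1 +
  i x)^(k + 1).\<close>

lemma pderiv_cpoly_spoly:
  "pderiv (cpoly (Suc k)) = smult (- of_nat (Suc k)) (spoly k) \<and>
   pderiv (spoly (Suc k)) = smult (of_nat (Suc k)) (cpoly k)"
proof (induction k)
  case (Suc k)
  have c: "pderiv (cpoly (Suc (Suc k))) = pderiv (cpoly (Suc k)) - (spoly (Suc k) + pCons 0 (pderiv (spoly (Suc k))))"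
    by (simp only: cpoly.simps(2) pderiv_diff) (simp add: pderiv_pCons)
  have s: "pderiv (spoly (Suc (Suc k))) = pderiv (spoly (Suc k)) + (cpoly (Suc k) + pCons 0 (pderiv (cpoly (Suc k))))"
    by (simp only: spoly.simps(2) pderiv_add) (simp add: pderiv_pCons)
  show ?case
    unfolding c s Suc[THEN conjunct1] Suc[THEN conjunct2] by (intro conjI poly_ext) (simp_all add: algebra_simps)
qed (simp add: pderiv_pCons)

text \<open>The squared modulus of 1 + i x is 1 + x^2.\<close>

lemma cpoly_spoly_sum_of_squares: "(cpoly k)\<^sup>2 + (spoly k)\<^sup>2 = [:1, 0, 1:] ^ k"
proof (induction k)
  case (Suc k)
  have "(cpoly (Suc k))\<^sup>2 + (spoly (Suc k))\<^sup>2 = [:1, 0, 1:] * ((cpoly k)\<^sup>2 + (spoly k)\<^sup>2)"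
    by (rule poly_ext) (simp add: power2_eq_square algebra_simps)
  then show ?case by (simp add: Suc)
qed simp

text \<open>After inserting the derivatives and the recursion, the cross terms cancel and leave a
  multiple of the sum of squares.\<close>

lemma wronskian_cpoly_spoly:
  "wronskian (cpoly (Suc k)) (spoly (Suc k)) = smult (of_nat (Suc k)) ([:1, 0, 1:] ^ k)"
proof -
  have "wronskian (cpoly (Suc k)) (spoly (Suc k)) = smult (of_nat (Suc k)) ((cpoly k)\<^sup>2 + (spoly k)\<^sup>2)"
    unfolding wronskian_def pderiv_cpoly_spoly[THEN conjunct1] pderiv_cpoly_spoly[THEN conjunct2]
    by (rule poly_ext) (simp add: power2_eq_square algebra_simps)
  then show ?thesis by (simp add: cpoly_spoly_sum_of_squares)
qed

text \<open>On the circle the Wronskian form of the model pair is the constant k + 1 and its loop is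
  exp (2 pi i (k + 1) t).\<close>

lemma winding_pencils_nonempty:
  assumes "n = Suc k + 2 * m"
  shows "winding_pencils n (of_nat (Suc k)) \<noteq> {}"
proof -
  define P where "P = [:1, 0, 1:] ^ m * cpoly (Suc k)"
  define Q where "Q = [:1, 0, 1:] ^ m * spoly (Suc k)"
  have deg: "degree P \<le> n" "degree Q \<le> n"
    unfolding P_def Q_def assms
    using degree_cpoly_spoly[of "Suc k"] by (blast intro: degree_one_plus_square_power_mult)+
  \<comment> \<open>The \<open>2 * m + k\<close> quadratic factors exhaust the degree
    \<open>2 * n - 2\<close>, so there is no zero at infinity. The trailing \<open>* 1\<close>, like
    \<open>0 +\<close> below, fits the rule for powers of \<open>[:1, 0, 1:]\<close> applied to the
    polynomial 1.\<close>
  have "wronskian P Q = smult (of_nat (Suc k)) ([:1, 0, 1:] ^ (2 * m + k) * 1)"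
    unfolding P_def Q_def wronskian_mult wronskian_cpoly_spoly
    by (simp add: power_add power_even_eq)
  moreover have "2 * n - 2 = 0 + 2 * (2 * m + k)" using assms by simp
  ultimately have "homog (2 * n - 2) (wronskian P Q) (sin t) (cos t) = of_nat (Suc k)" for t
    by (simp only: homog_smult homog_one_plus_square_power_mult degree_1) (simp add: homog_def)
  then have pos: "positive_frame n P Q"
    using deg by (simp add: positive_frame_def)
  have "frame_loop n P Q = exp \<circ> (\<lambda>t. of_nat (Suc k) * (2 * of_real pi * \<i> * of_real t))"
  proof
    fix t
    have "frame_loop n P Q t = Complex (homog (Suc k) (cpoly (Suc k)) (sin (2 * pi * t)) (cos (2 * pi * t)))
        (homog (Suc k) (spoly (Suc k)) (sin (2 * pi * t)) (cos (2 * pi * t)))"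
      unfolding frame_loop_def P_def Q_def assms
      using degree_cpoly_spoly[of "Suc k"] by (simp only: homog_one_plus_square_power_mult) simp
    also have "\<dots> = cis (2 * pi * t) ^ Suc k"
      unfolding homog_cpoly_spoly by (simp add: cis.code)
    also have "\<dots> = exp (of_nat (Suc k) * (2 * of_real pi * \<i> * of_real t))"
      unfolding cis_conv_exp exp_of_nat_mult[symmetric] by (simp add: algebra_simps)
    finally show "frame_loop n P Q t = (exp \<circ> (\<lambda>t. of_nat (Suc k) * (2 * of_real pi * \<i> * of_real t))) t"
      by simp
  qed
  moreover have "path (\<lambda>t. of_nat (Suc k) * (2 * of_real pi * \<i> * of_real t) :: complex)"
    unfolding path_def by (intro continuous_intros)
  ultimately have "winding_number (frame_loop n P Q) 0 = of_nat (Suc k)"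
    by (simp only: winding_number_compose_exp) (simp add: pathfinish_def pathstart_def)
  with pos show ?thesis by (auto simp: winding_pencils_def)
qed

section \<open>Connected components\<close>

lemma topspace_generic_grassmannian:
  "topspace (generic_grassmannian n) = {L \<in> pencils n. generic_pencil n L}"
  by (auto simp: generic_grassmannian_def topspace_grassmannian nongeneric_pencils_def)

lemma winding_pencils_subset_generic:
  "winding_pencils n k \<subseteq> topspace (generic_grassmannian n)"
proof
  fix L assume "L \<in> winding_pencils n k"
  note L = winding_pencil_no_real_zeros[OF this]
  then have "generic_pencil n L"
    by (simp add: wronskian_no_real_zeros_def generic_pencil_def)
  with L show "L \<in> topspace (generic_grassmannian n)" by (simp add: topspace_generic_grassmannian)
qed

text \<open>Within the generic pencils the complement is covered by open sets: the pencils with a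
  sign change and those with another winding number.\<close>

lemma clopen_winding_pencils:
  assumes "n \<ge> 1"
  shows "openin (generic_grassmannian n) (winding_pencils n k)"
    and "closedin (generic_grassmannian n) (winding_pencils n k)"
proof -
  let ?G = "topspace (generic_grassmannian n)"
  have op: "openin (generic_grassmannian n) (U \<inter> ?G)" if "openin (grassmannian n) U" for U
  proof -
    have "U \<inter> ?G = U \<inter> (pencils n - nongeneric_pencils n)"
      by (auto simp: topspace_generic_grassmannian nongeneric_pencils_def)
    then show ?thesis using that by (auto simp: generic_grassmannian_def openin_subtopology)
  qed
  show "openin (generic_grassmannian n) (winding_pencils n k)"
    using op[OF openin_winding_pencils[OF assms, of k]] winding_pencils_subset_generic[of n k]
    by (simp add: Int_absorb2)
  have "?G - winding_pencils n k
      = (sign_changing_pencils n \<union> (\<Union>j\<in>- {k}. winding_pencils n j)) \<inter> ?G"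
  proof (intro equalityI subsetI)
    fix L assume L: "L \<in> ?G - winding_pencils n k"
    then have "L \<in> sign_changing_pencils n \<or> (\<exists>j. L \<in> winding_pencils n j)"
      using generic_pencil_cases by (simp add: topspace_generic_grassmannian)
    with L show "L \<in> (sign_changing_pencils n \<union> (\<Union>j\<in>- {k}. winding_pencils n j)) \<inter> ?G"
      by blast
  next
    fix L assume L: "L \<in> (sign_changing_pencils n \<union> (\<Union>j\<in>- {k}. winding_pencils n j)) \<inter> ?G"
    then have "L \<notin> winding_pencils n k"
      using winding_pencil_no_real_zeros(3) winding_pencils_disjoint[OF assms] by blast
    with L show "L \<in> ?G - winding_pencils n k" by blast
  qed
  moreover have "openin (grassmannian n) (sign_changing_pencils n \<union> (\<Union>j\<in>- {k}. winding_pencils n j))"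
    using openin_sign_changing_pencils openin_winding_pencils[OF assms] by (intro openin_Un) auto
  ultimately show "closedin (generic_grassmannian n) (winding_pencils n k)"
    unfolding closedin_def using op winding_pencils_subset_generic by simp
qed

theorem corollary1:
  fixes n :: nat
  assumes "n \<ge> 1"
  shows "\<exists>\<C>. \<C> \<subseteq> connected_components_of (generic_grassmannian n) \<and>
           finite \<C> \<and> card \<C> = (n + 1) div 2 \<and>
           (\<forall>C\<in>\<C>. \<forall>L\<in>C. wronskian_no_real_zeros n L)"
proof -
  let ?X = "generic_grassmannian n"
  \<comment> \<open>Here \<open>m\<close> counts the factors 1 + x^2. The winding number
    \<open>n - 2 * m\<close> is positive exactly for \<open>2 * m < n\<close>, which leaves
    \<open>(n + 1) div 2\<close> values of \<open>m\<close>.\<close>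
  let ?T = "\<lambda>m. winding_pencils n (of_nat (n - 2 * m))"
  define M where "M = {..<(n + 1) div 2}"
  have "\<exists>L. L \<in> ?T m" if "m \<in> M" for m
  proof -
    have "2 * m < n" using that by (simp add: M_def)
    then have "n = Suc (n - 2 * m - 1) + 2 * m" and k: "Suc (n - 2 * m - 1) = n - 2 * m"
      by linarith+
    from winding_pencils_nonempty[OF this(1)] show ?thesis unfolding k by blast
  qed
  then obtain L where L: "\<And>m. m \<in> M \<Longrightarrow> L m \<in> ?T m" by metis
  define C where "C m = connected_component_of_set ?X (L m)" for m
  have top: "L m \<in> topspace ?X" if "m \<in> M" for m
    using L[OF that] winding_pencils_subset_generic by blast
  have self: "L m \<in> C m" if "m \<in> M" for m
    using top[OF that] by (simp add: C_def connected_component_of_refl)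
  \<comment> \<open>A connected set that meets a clopen set lies inside it.\<close>
  have sub: "C m \<subseteq> ?T m" if "m \<in> M" for m
    using connectedin_clopen_cases[OF connectedin_connected_component_of clopen_winding_pencils(2,1)[OF assms]]
      self[OF that] L[OF that] unfolding C_def disjnt_iff by blast
  have "inj_on C M"
  proof (rule inj_onI)
    fix i j assume ij: "i \<in> M" "j \<in> M" "C i = C j"
    then have "L i \<in> ?T i" "L i \<in> ?T j" using self sub L by blast+
    then have "n - 2 * i = n - 2 * j" by (metis winding_pencils_disjoint[OF assms] of_nat_eq_iff)
    \<comment> \<open>These bounds exclude truncation in the natural subtraction, so equal winding
      numbers give equal indices.\<close>
    moreover have "2 * i < n" "2 * j < n" using ij by (simp_all add: M_def)
    ultimately show "i = j" by linarith
  qed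
  then have "card (C ` M) = (n + 1) div 2" by (simp add: card_image M_def)
  moreover have "C ` M \<subseteq> connected_components_of ?X"
    using top by (auto simp: C_def connected_component_in_connected_components_of)
  moreover have "\<forall>D\<in>C ` M. \<forall>K\<in>D. wronskian_no_real_zeros n K"
    using sub winding_pencil_no_real_zeros(2) by blast
  ultimately show ?thesis by (intro exI[of _ "C ` M"]) (simp add: M_def)
qed

end
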